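(* Let $(M,G,\mathcal J)$ be a generalized almost Hermitian manifold, $X_{0}\in\mathfrak X(M)$ a non-vanishing vector field and $f\in C^{\infty}(M)$ a non-vanishing function. Denote by $L_{i}$ the $(1,0)$-bundles of $\mathcal J_{i}$ ($i=1,2$), where $\mathcal J_{1}=\mathcal J$, $\mathcal J_{2}=G^{\mathrm{end}}\mathcal J$. Let $(G',\mathcal J)$ be the elementary deformation of $(G,\mathcal J)$ by $X_{0}$ and $f$, and let $L_{2}'=L(E_{2}',\epsilon_{2}')$ be the $(1,0)$-bundle of the second generalized almost complex structure $\mathcal J_{2}'=(G^{\mathrm{end}})'\mathcal J$ of $(G',\mathcal J)$. Then $$L_{1}\cap L_{2}'=\mathrm{span}_{\mathbb{C}}\{v_{f}\}+L_{1}\cap L_{2}\cap\mathcal S_{\mathbb{C}}^{\perp},\qquad L_{1}\cap\bar L_{2}'=\mathrm{span}_{\mathbb{C}}\{v_{if}\}+L_{1}\cap\bar L_{2}\cap\mathcal S_{\mathbb{C}}^{\perp}$$ and $$\mathrm{pr}_{T}(L_{1}\cap L_{2}')=\mathrm{span}_{\mathbb{C}}\{\mathrm{pr}_{T}(v_{f})\}+\mathrm{pr}_{T}(L_{1}\cap L_{2}\cap\mathcal S_{\mathbb{C}}^{\perp}),\qquad\mathrm{pr}_{T}(L_{1}\cap\bar L_{2}')=\mathrm{span}_{\mathbb{C}}\{\mathrm{pr}_{T}(v_{if})\}+\mathrm{pr}_{T}(L_{1}\cap\bar L_{2}\cap\mathcal S_{\mathbb{C}}^{\perp})$$ are all direct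 sum decompositions.
   Context: $\mathbb{T}M=TM\oplus T^{*}M$ with projection $\mathrm{pr}_{T}$ to $TM$, and $\langle X+\xi,Y+\eta\rangle=\frac12(\eta(X)+\xi(Y))$, everything extended complex (bi)linearly. A generalized almost complex structure is $\mathcal J\in\Gamma\,\mathrm{End}(\mathbb{T}M)$ with $\mathcal J^{2}=-\mathrm{Id}$, skew-symmetric for $\langle\cdot,\cdot\rangle$; its $(1,0)$-bundle is its $i$-eigenbundle in $(\mathbb{T}M)^{\mathbb{C}}$. For a complex subbundle $E\subset(TM)^{\mathbb{C}}$ and $\epsilon\in\Gamma(\Lambda^{2}E^{*})$, $L(E,\epsilon)=\{X+\xi\in E\oplus(T^{*}M)^{\mathbb{C}}:\xi|_{E}=i_{X}\epsilon\}$; structures are assumed of constant type, so that $(1,0)$-bundles have this form. A generalized almost Hermitian structure $(G,\mathcal J)$ is a positive definite metric $G$ on $\mathbb{T}M$ and a $G$-orthogonal generalized almost complex structure $\mathcal J$ such that $G^{\mathrm{end}}$, defined by $G(u,v)=\langle G^{\mathrm{end}}u,v\rangle$, satisfies $(G^{\mathrm{end}})^{2}=\mathrm{Id}$. Put $\mathcal J_{1}=\mathcal J$, $\mathcal J_{2}=G^{\mathrm{end}}\mathcal J$, $\mathcal J_{3}=\mathcal J_{1}\mathcal J_{2}=-G^{\mathrm{end}}$. Elementary deformation: let $\mathcal S=\mathrm{span}\{X_{0},\mathcal J_{1}X_{0},\mathcal J_{2}X_{0},\mathcal J_{3}X_{0}\}$ (rank $4$), $\mathcal S_{\mathbb{C}}$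 its complexification, and $\mathcal S^{\perp}$ its orthogonal complement (the same with respect to $G$ and $\langle\cdot,\cdot\rangle$), with complexification $\mathcal S^{\perp}_{\mathbb{C}}$. Let $\tau\in\mathrm{Aut}(\mathbb{T}M)$ be the identity on $\mathcal S^{\perp}$ and $X_{0}\mapsto fX_{0}$, $\mathcal JX_{0}\mapsto f\mathcal JX_{0}$, $\mathcal J_{2}X_{0}\mapsto\frac1f\mathcal J_{2}X_{0}$, $\mathcal J_{3}X_{0}\mapsto\frac1f\mathcal J_{3}X_{0}$ on $\mathcal S$. The elementary deformation of $(G,\mathcal J)$ by $X_{0}$ and $f$ is the generalized almost Hermitian structure $(G',\mathcal J)$, $G'=(\tau^{-1})^{*}G$; $(G^{\mathrm{end}})'$ is its endomorphism, $G'(u,v)=\langle(G^{\mathrm{end}})'u,v\rangle$. Finally $$v_{f}:=X_{0}-i\mathcal JX_{0}-\tfrac{1}{f^{2}}(\mathcal J_{3}X_{0}+i\mathcal J_{2}X_{0}),\qquad v_{if}:=X_{0}-i\mathcal JX_{0}+\tfrac{1}{f^{2}}(\mathcal J_{3}X_{0}+i\mathcal J_{2}X_{0}).$$ *)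

theory Defs
  imports "HOL-Analysis.Analysis"
begin

section \<open>Smooth maps between open subsets of normed spaces\<close>

text \<open>
  Only used for open \<open>S\<close>; the domain will always be a Euclidean space, where differentiability
  of all iterated directional derivatives is the usual notion of a \<open>C\<^sup>\<infinity>\<close> map.
\<close>

fun Ck_on :: "nat \<Rightarrow> 'a::real_normed_vector set \<Rightarrow> ('a \<Rightarrow> 'b::real_normed_vector) \<Rightarrow> bool" where
  "Ck_on 0 S f = continuous_on S f"
| "Ck_on (Suc k) S f =
     ((\<forall>x\<in>S. f differentiable (at x)) \<and> (\<forall>v. Ck_on k S (\<lambda>x. frechet_derivative f (at x) v)))"

definition smooth_on :: "'a::real_normed_vector set \<Rightarrow> ('a \<Rightarrow> 'b::real_normed_vector) \<Rightarrow> bool" where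
  "smooth_on S f \<longleftrightarrow> (\<forall>k. Ck_on k S f)"

section \<open>Smooth manifolds\<close>

text \<open>
  The manifold is a Hausdorff, second countable topological space given as a type \<open>'m\<close>, with a
  smooth atlas of charts into a Euclidean space \<open>'e\<close>. A chart is a domain with a coordinate map.
\<close>

type_synonym ('m, 'e) chart = "'m set \<times> ('m \<Rightarrow> 'e)"

abbreviation cdom :: "('m, 'e) chart \<Rightarrow> 'm set" where "cdom \<equiv> fst"
abbreviation cmap :: "('m, 'e) chart \<Rightarrow> 'm \<Rightarrow> 'e" where "cmap \<equiv> snd"

definition cinv :: "('m, 'e) chart \<Rightarrow> 'e \<Rightarrow> 'm" where
  "cinv c = inv_into (cdom c) (cmap c)"

definition smooth_atlas ::
  "('m::{t2_space,second_countable_topology}, 'e::euclidean_space) chart set \<Rightarrow> bool" where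
  "smooth_atlas A \<longleftrightarrow>
     (\<Union>c\<in>A. cdom c) = UNIV \<and>
     (\<forall>c\<in>A. open (cdom c) \<and> open (cmap c ` cdom c) \<and>
        homeomorphism (cdom c) (cmap c ` cdom c) (cmap c) (cinv c)) \<and>
     (\<forall>c\<in>A. \<forall>d\<in>A. smooth_on (cmap c ` (cdom c \<inter> cdom d)) (cmap d \<circ> cinv c))"

text \<open>
  The tangent space at \<open>p\<close> is the model space \<open>'e\<close>, a tangent vector being represented by its
  components in a chart \<open>chart_at A p\<close> of the atlas chosen once and for all at \<open>p\<close>.
  The map \<open>dtrans p c d\<close> is the tangent coordinate change at \<open>p\<close> from \<open>c\<close> to \<open>d\<close>.
  Smoothness of sections is always tested on their components in the charts of the atlas, so
  that it does not depend on how \<open>chart_at A p\<close> varies with \<open>p\<close>.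
\<close>

definition chart_at :: "('m, 'e) chart set \<Rightarrow> 'm \<Rightarrow> ('m, 'e) chart" where
  "chart_at A p = (SOME c. c \<in> A \<and> p \<in> cdom c)"

definition dtrans ::
  "'m \<Rightarrow> ('m, 'e::euclidean_space) chart \<Rightarrow> ('m, 'e) chart \<Rightarrow> 'e \<Rightarrow> 'e" where
  "dtrans p c d = frechet_derivative (cmap d \<circ> cinv c) (at (cmap c p))"

definition tan_to_chart ::
  "('m, 'e::euclidean_space) chart set \<Rightarrow> ('m, 'e) chart \<Rightarrow> 'm \<Rightarrow> 'e \<Rightarrow> 'e" where
  "tan_to_chart A c p = dtrans p (chart_at A p) c"

definition tan_of_chart ::
  "('m, 'e::euclidean_space) chart set \<Rightarrow> ('m, 'e) chart \<Rightarrow> 'm \<Rightarrow> 'e \<Rightarrow> 'e" where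
  "tan_of_chart A c p = dtrans p c (chart_at A p)"

text \<open>Smoothness on an open set \<open>U\<close> of a quantity \<open>F c p\<close> given by its components in each chart \<open>c\<close>.\<close>

definition smooth_in_charts_on ::
  "('m, 'e::euclidean_space) chart set \<Rightarrow> 'm set
     \<Rightarrow> (('m, 'e) chart \<Rightarrow> 'm \<Rightarrow> 'b::real_normed_vector) \<Rightarrow> bool" where
  "smooth_in_charts_on A U F \<longleftrightarrow>
     (\<forall>c\<in>A. smooth_on (cmap c ` (cdom c \<inter> U)) (\<lambda>x. F c (cinv c x)))"

definition smooth_function_on ::
  "('m, 'e::euclidean_space) chart set \<Rightarrow> 'm set \<Rightarrow> ('m \<Rightarrow> 'b::real_normed_vector) \<Rightarrow> bool" where
  "smooth_function_on A U f \<longleftrightarrow> smooth_in_charts_on A U (\<lambda>c. f)"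

definition smooth_vector_field_on ::
  "('m, 'e::euclidean_space) chart set \<Rightarrow> 'm set \<Rightarrow> ('m \<Rightarrow> 'e) \<Rightarrow> bool" where
  "smooth_vector_field_on A U X \<longleftrightarrow> smooth_in_charts_on A U (\<lambda>c p. tan_to_chart A c p (X p))"

section \<open>The generalized tangent bundle\<close>

text \<open>Fibre of \<open>TM \<oplus> T\<^sup>*M\<close>: the element \<open>X + \<xi>\<close> is the pair \<open>(X, \<xi>)\<close>, and \<open>pr\<^sub>T\<close> is \<open>fst\<close>.\<close>

type_synonym 'e gtan = "'e \<times> ('e \<Rightarrow>\<^sub>L real)"

definition pairing :: "'e::euclidean_space gtan \<Rightarrow> 'e gtan \<Rightarrow> real" where
  "pairing u v = (blinfun_apply (snd v) (fst u) + blinfun_apply (snd u) (fst v)) / 2"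

definition gtan_to_chart ::
  "('m, 'e::euclidean_space) chart set \<Rightarrow> ('m, 'e) chart \<Rightarrow> 'm \<Rightarrow> 'e gtan \<Rightarrow> 'e gtan" where
  "gtan_to_chart A c p u =
     (tan_to_chart A c p (fst u), Blinfun (\<lambda>y. blinfun_apply (snd u) (tan_of_chart A c p y)))"

definition gtan_of_chart ::
  "('m, 'e::euclidean_space) chart set \<Rightarrow> ('m, 'e) chart \<Rightarrow> 'm \<Rightarrow> 'e gtan \<Rightarrow> 'e gtan" where
  "gtan_of_chart A c p u =
     (tan_of_chart A c p (fst u), Blinfun (\<lambda>y. blinfun_apply (snd u) (tan_to_chart A c p y)))"

definition smooth_endomorphism ::
  "('m, 'e::euclidean_space) chart set \<Rightarrow> ('m \<Rightarrow> 'e gtan \<Rightarrow> 'e gtan) \<Rightarrow> bool" where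
  "smooth_endomorphism A J \<longleftrightarrow>
     (\<forall>p. linear (J p)) \<and>
     (\<forall>u. smooth_in_charts_on A UNIV (\<lambda>c p. gtan_to_chart A c p (J p (gtan_of_chart A c p u))))"

definition smooth_bilinear_form ::
  "('m, 'e::euclidean_space) chart set \<Rightarrow> ('m \<Rightarrow> 'e gtan \<Rightarrow> 'e gtan \<Rightarrow> real) \<Rightarrow> bool" where
  "smooth_bilinear_form A G \<longleftrightarrow>
     (\<forall>p. bilinear (G p)) \<and>
     (\<forall>u v. smooth_in_charts_on A UNIV
        (\<lambda>c p. G p (gtan_of_chart A c p u) (gtan_of_chart A c p v)))"

definition generalized_almost_complex ::
  "('m, 'e::euclidean_space) chart set \<Rightarrow> ('m \<Rightarrow> 'e gtan \<Rightarrow> 'e gtan) \<Rightarrow> bool" where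
  "generalized_almost_complex A J \<longleftrightarrow>
     smooth_endomorphism A J \<and>
     (\<forall>p u. J p (J p u) = - u) \<and>
     (\<forall>p u v. pairing (J p u) v = - pairing u (J p v))"

definition positive_definite_metric ::
  "('m, 'e::euclidean_space) chart set \<Rightarrow> ('m \<Rightarrow> 'e gtan \<Rightarrow> 'e gtan \<Rightarrow> real) \<Rightarrow> bool" where
  "positive_definite_metric A G \<longleftrightarrow>
     smooth_bilinear_form A G \<and>
     (\<forall>p u v. G p u v = G p v u) \<and>
     (\<forall>p u. u \<noteq> 0 \<longrightarrow> G p u u > 0)"

text \<open>The description determines \<open>w\<close> uniquely since \<open>pairing\<close> is nondegenerate.\<close>

definition Gend ::
  "('m \<Rightarrow> 'e::euclidean_space gtan \<Rightarrow> 'e gtan \<Rightarrow> real) \<Rightarrow> 'm \<Rightarrow> 'e gtan \<Rightarrow> 'e gtan" where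
  "Gend G p u = (THE w. \<forall>v. G p u v = pairing w v)"

definition generalized_almost_hermitian ::
  "('m, 'e::euclidean_space) chart set \<Rightarrow> ('m \<Rightarrow> 'e gtan \<Rightarrow> 'e gtan \<Rightarrow> real)
     \<Rightarrow> ('m \<Rightarrow> 'e gtan \<Rightarrow> 'e gtan) \<Rightarrow> bool" where
  "generalized_almost_hermitian A G J \<longleftrightarrow>
     positive_definite_metric A G \<and>
     generalized_almost_complex A J \<and>
     (\<forall>p u v. G p (J p u) (J p v) = G p u v) \<and>
     (\<forall>p u. Gend G p (Gend G p u) = u)"

definition J2 ::
  "('m \<Rightarrow> 'e::euclidean_space gtan \<Rightarrow> 'e gtan \<Rightarrow> real) \<Rightarrow> ('m \<Rightarrow> 'e gtan \<Rightarrow> 'e gtan)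
     \<Rightarrow> 'm \<Rightarrow> 'e gtan \<Rightarrow> 'e gtan" where
  "J2 G J p u = Gend G p (J p u)"

definition J3 ::
  "('m \<Rightarrow> 'e::euclidean_space gtan \<Rightarrow> 'e gtan \<Rightarrow> real) \<Rightarrow> ('m \<Rightarrow> 'e gtan \<Rightarrow> 'e gtan)
     \<Rightarrow> 'm \<Rightarrow> 'e gtan \<Rightarrow> 'e gtan" where
  "J3 G J p u = J p (J2 G J p u)"

section \<open>Complexification\<close>

text \<open>The element \<open>u + i w\<close> of the complexification of a real vector space is the pair \<open>(u, w)\<close>.\<close>

type_synonym 'v cpx = "'v \<times> 'v"

definition cscale :: "complex \<Rightarrow> 'v::real_vector cpx \<Rightarrow> 'v cpx" where
  "cscale a z = (Re a *\<^sub>R fst z - Im a *\<^sub>R snd z, Re a *\<^sub>R snd z + Im a *\<^sub>R fst z)"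

definition cpx_of :: "'v::real_vector \<Rightarrow> 'v cpx" where
  "cpx_of u = (u, 0)"

definition cpx_cnj :: "'v::real_vector cpx \<Rightarrow> 'v cpx" where
  "cpx_cnj z = (fst z, - snd z)"

text \<open>Complex-linear extension of a real linear map, and complexification of a real subspace.\<close>

definition cpx_map :: "('v \<Rightarrow> 'w) \<Rightarrow> 'v cpx \<Rightarrow> 'w cpx" where
  "cpx_map F z = (F (fst z), F (snd z))"

definition cpx_subspace :: "'v set \<Rightarrow> 'v cpx set" where
  "cpx_subspace W = W \<times> W"

interpretation cpx: vector_space "cscale :: complex \<Rightarrow> 'v::real_vector cpx \<Rightarrow> 'v cpx"
  by unfold_locales (simp_all add: cscale_def algebra_simps prod_eq_iff)

definition prT :: "'e::euclidean_space gtan cpx \<Rightarrow> 'e cpx" where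
  "prT = cpx_map fst"

text \<open>The \<open>(1,0)\<close>-bundle, i.e. the \<open>i\<close>-eigenbundle in the complexification.\<close>

definition L10 ::
  "('m \<Rightarrow> 'e::euclidean_space gtan \<Rightarrow> 'e gtan) \<Rightarrow> 'm \<Rightarrow> 'e gtan cpx set" where
  "L10 J p = {z. cpx_map (J p) z = cscale \<i> z}"

definition constant_type :: "('m \<Rightarrow> 'e::euclidean_space gtan \<Rightarrow> 'e gtan) \<Rightarrow> bool" where
  "constant_type J \<longleftrightarrow> (\<exists>k. \<forall>p. cpx.dim (prT ` L10 J p) = k)"

section \<open>Complex subbundles of the complexified tangent bundle and the bundles \<open>L(E, \<epsilon>)\<close>\<close>

definition smooth_complex_vector_field_on ::
  "('m, 'e::euclidean_space) chart set \<Rightarrow> 'm set \<Rightarrow> ('m \<Rightarrow> 'e cpx) \<Rightarrow> bool" where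
  "smooth_complex_vector_field_on A U Z \<longleftrightarrow>
     smooth_vector_field_on A U (\<lambda>p. fst (Z p)) \<and> smooth_vector_field_on A U (\<lambda>p. snd (Z p))"

definition complex_subbundle ::
  "('m::topological_space, 'e::euclidean_space) chart set \<Rightarrow> ('m \<Rightarrow> 'e cpx set) \<Rightarrow> bool" where
  "complex_subbundle A E \<longleftrightarrow>
     (\<exists>k::nat. \<forall>p. \<exists>U s. open U \<and> p \<in> U \<and>
        (\<forall>i<k. smooth_complex_vector_field_on A U (s i)) \<and>
        (\<forall>q\<in>U. inj_on (\<lambda>i. s i q) {..<k} \<and>
           cpx.independent ((\<lambda>i. s i q) ` {..<k}) \<and>
           cpx.span ((\<lambda>i. s i q) ` {..<k}) = E q))"

text \<open>\<open>\<epsilon> \<in> \<Gamma>(\<Lambda>\<^sup>2E\<^sup>*)\<close>; the values of \<open>\<epsilon> p\<close> outside \<open>E p\<close> are irrelevant.\<close>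

definition smooth_two_form_on_subbundle ::
  "('m::topological_space, 'e::euclidean_space) chart set \<Rightarrow> ('m \<Rightarrow> 'e cpx set)
     \<Rightarrow> ('m \<Rightarrow> 'e cpx \<Rightarrow> 'e cpx \<Rightarrow> complex) \<Rightarrow> bool" where
  "smooth_two_form_on_subbundle A E \<epsilon> \<longleftrightarrow>
     (\<forall>p. \<forall>X\<in>E p. \<forall>Y\<in>E p. \<forall>Z\<in>E p. \<forall>a b.
        \<epsilon> p (cscale a X + cscale b Y) Z = a * \<epsilon> p X Z + b * \<epsilon> p Y Z) \<and>
     (\<forall>p. \<forall>X\<in>E p. \<forall>Y\<in>E p. \<epsilon> p X Y = - \<epsilon> p Y X) \<and>
     (\<forall>U X Y. open U \<and>
        smooth_complex_vector_field_on A U X \<and> smooth_complex_vector_field_on A U Y \<and>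
        (\<forall>q\<in>U. X q \<in> E q \<and> Y q \<in> E q)
        \<longrightarrow> smooth_function_on A U (\<lambda>q. \<epsilon> q (X q) (Y q)))"

text \<open>The complex covector \<open>\<xi> + i \<eta>\<close> evaluated at the complex vector \<open>Y + i Z\<close>.\<close>

definition cpx_covector_apply :: "('e::euclidean_space \<Rightarrow>\<^sub>L real) cpx \<Rightarrow> 'e cpx \<Rightarrow> complex" where
  "cpx_covector_apply \<xi> Y =
     Complex (blinfun_apply (fst \<xi>) (fst Y) - blinfun_apply (snd \<xi>) (snd Y))
             (blinfun_apply (fst \<xi>) (snd Y) + blinfun_apply (snd \<xi>) (fst Y))"

definition L_of ::
  "('m \<Rightarrow> 'e::euclidean_space cpx set) \<Rightarrow> ('m \<Rightarrow> 'e cpx \<Rightarrow> 'e cpx \<Rightarrow> complex)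
     \<Rightarrow> 'm \<Rightarrow> 'e gtan cpx set" where
  "L_of E \<epsilon> p =
     {z. prT z \<in> E p \<and> (\<forall>Y\<in>E p. cpx_covector_apply (cpx_map snd z) Y = \<epsilon> p (prT z) Y)}"

section \<open>Elementary deformations\<close>

definition gvec :: "('m \<Rightarrow> 'e::euclidean_space) \<Rightarrow> 'm \<Rightarrow> 'e gtan" where
  "gvec X p = (X p, 0)"

definition S_bundle ::
  "('m \<Rightarrow> 'e::euclidean_space gtan \<Rightarrow> 'e gtan \<Rightarrow> real) \<Rightarrow> ('m \<Rightarrow> 'e gtan \<Rightarrow> 'e gtan)
     \<Rightarrow> ('m \<Rightarrow> 'e) \<Rightarrow> 'm \<Rightarrow> 'e gtan set" where
  "S_bundle G J X0 p =
     span {gvec X0 p, J p (gvec X0 p), J2 G J p (gvec X0 p), J3 G J p (gvec X0 p)}"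

definition S_perp ::
  "('m \<Rightarrow> 'e::euclidean_space gtan \<Rightarrow> 'e gtan \<Rightarrow> real) \<Rightarrow> ('m \<Rightarrow> 'e gtan \<Rightarrow> 'e gtan)
     \<Rightarrow> ('m \<Rightarrow> 'e) \<Rightarrow> 'm \<Rightarrow> 'e gtan set" where
  "S_perp G J X0 p = {u. \<forall>s\<in>S_bundle G J X0 p. G p u s = 0}"

text \<open>
  The fibre at \<open>p\<close> is the orthogonal direct sum of \<open>S_bundle\<close> and \<open>S_perp\<close>, and the four
  spanning vectors of \<open>S_bundle\<close> are linearly independent where \<open>X0\<close> does not vanish. Hence
  there is exactly one linear map as described; it is bijective because \<open>f p \<noteq> 0\<close>.
\<close>

definition elementary_tau ::
  "('m \<Rightarrow> 'e::euclidean_space gtan \<Rightarrow> 'e gtan \<Rightarrow> real) \<Rightarrow> ('m \<Rightarrow> 'e gtan \<Rightarrow> 'e gtan)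
     \<Rightarrow> ('m \<Rightarrow> 'e) \<Rightarrow> ('m \<Rightarrow> real) \<Rightarrow> 'm \<Rightarrow> 'e gtan \<Rightarrow> 'e gtan" where
  "elementary_tau G J X0 f p =
     (THE T. linear T \<and> bij T \<and> (\<forall>u\<in>S_perp G J X0 p. T u = u) \<and>
        T (gvec X0 p) = f p *\<^sub>R gvec X0 p \<and>
        T (J p (gvec X0 p)) = f p *\<^sub>R J p (gvec X0 p) \<and>
        T (J2 G J p (gvec X0 p)) = (1 / f p) *\<^sub>R J2 G J p (gvec X0 p) \<and>
        T (J3 G J p (gvec X0 p)) = (1 / f p) *\<^sub>R J3 G J p (gvec X0 p))"

definition elementary_deformation ::
  "('m \<Rightarrow> 'e::euclidean_space gtan \<Rightarrow> 'e gtan \<Rightarrow> real) \<Rightarrow> ('m \<Rightarrow> 'e gtan \<Rightarrow> 'e gtan)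
     \<Rightarrow> ('m \<Rightarrow> 'e) \<Rightarrow> ('m \<Rightarrow> real) \<Rightarrow> 'm \<Rightarrow> 'e gtan \<Rightarrow> 'e gtan \<Rightarrow> real" where
  "elementary_deformation G J X0 f p u v =
     G p (inv (elementary_tau G J X0 f p) u) (inv (elementary_tau G J X0 f p) v)"

definition v_f ::
  "('m \<Rightarrow> 'e::euclidean_space gtan \<Rightarrow> 'e gtan \<Rightarrow> real) \<Rightarrow> ('m \<Rightarrow> 'e gtan \<Rightarrow> 'e gtan)
     \<Rightarrow> ('m \<Rightarrow> 'e) \<Rightarrow> ('m \<Rightarrow> real) \<Rightarrow> 'm \<Rightarrow> 'e gtan cpx" where
  "v_f G J X0 f p =
     cpx_of (gvec X0 p) - cscale \<i> (cpx_of (J p (gvec X0 p)))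
     - cscale (of_real (1 / (f p)\<^sup>2))
         (cpx_of (J3 G J p (gvec X0 p)) + cscale \<i> (cpx_of (J2 G J p (gvec X0 p))))"

definition v_if ::
  "('m \<Rightarrow> 'e::euclidean_space gtan \<Rightarrow> 'e gtan \<Rightarrow> real) \<Rightarrow> ('m \<Rightarrow> 'e gtan \<Rightarrow> 'e gtan)
     \<Rightarrow> ('m \<Rightarrow> 'e) \<Rightarrow> ('m \<Rightarrow> real) \<Rightarrow> 'm \<Rightarrow> 'e gtan cpx" where
  "v_if G J X0 f p =
     cpx_of (gvec X0 p) - cscale \<i> (cpx_of (J p (gvec X0 p)))
     + cscale (of_real (1 / (f p)\<^sup>2))
         (cpx_of (J3 G J p (gvec X0 p)) + cscale \<i> (cpx_of (J2 G J p (gvec X0 p))))"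

text \<open>\<open>W\<close> is the internal direct sum of \<open>U\<close> and \<open>V\<close>.\<close>

definition direct_sum_decomposition :: "'v::ab_group_add set \<Rightarrow> 'v set \<Rightarrow> 'v set \<Rightarrow> bool" where
  "direct_sum_decomposition W U V \<longleftrightarrow> W = {u + v | u v. u \<in> U \<and> v \<in> V} \<and> U \<inter> V = {0}"

end

theory Submission
  imports Defs
begin

text \<open>
  Everything happens in one fibre. Write \<open>K\<close> for \<open>G\<^sup>e\<^sup>n\<^sup>d\<close> and \<open>K'\<close> for its deformation. Both
  \<open>J\<close> and \<open>K\<close> preserve \<open>G\<close>, they commute, and therefore \<open>J\<^sub>3 = -K\<close>. On the \<open>i\<close>-eigenspace \<open>L\<^sub>1\<close> of
  \<open>J\<close> the condition \<open>K'J z = i z\<close> just says \<open>K' z = z\<close>, and its conjugate version says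
  \<open>K' z = -z\<close>. So the two pairs of decompositions describe the part of \<open>L\<^sub>1\<close> in the eigenspace of
  \<open>K'\<close> for a sign \<open>s = 1\<close> or \<open>s = -1\<close>, and one argument treats both.

  The pairing is \<open>G(K u, v)\<close>, and a tangent vector is isotropic for it. With this,
  \<open>X\<^sub>0, J X\<^sub>0, J\<^sub>2 X\<^sub>0, J\<^sub>3 X\<^sub>0\<close> are \<open>G\<close>-orthogonal of equal length, so \<open>\<tau>\<close> rescales along an orthogonal
  family and is \<open>G\<close>-self-adjoint. Hence \<open>K' = K \<tau>\<^sup>-\<^sup>2\<close>: it commutes
  with \<open>J\<close>, equals \<open>K\<close> on \<open>S\<^sup>\<bottom>\<close> and sends \<open>X\<^sub>0\<close> to
  \<open>f\<^sup>-\<^sup>2 K X\<^sub>0\<close> and \<open>K X\<^sub>0\<close> to \<open>f\<^sup>2 X\<^sub>0\<close>. So \<open>a = X\<^sub>0 + s f\<^sup>-\<^sup>2 K X\<^sub>0\<close> and \<open>J a\<close> are \<open>s\<close>-eigenvectors, and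
  \<open>a - i J a\<close> is \<open>v\<^sub>f\<close> or \<open>v\<^sub>i\<^sub>f\<close>.

  Conversely, an \<open>s\<close>-eigenvector \<open>u\<close> of \<open>K'\<close> satisfies \<open>\<tau>\<^sup>-\<^sup>2 u = s K u\<close>. Taking
  \<open>G\<close>-products with \<open>K X\<^sub>0\<close> and \<open>K J X\<^sub>0\<close> shows that \<open>u\<close> is orthogonal to these as soon as it is orthogonal to \<open>X\<^sub>0\<close> and \<open>J X\<^sub>0\<close>. So
  subtracting the complex multiple of \<open>v\<^sub>f\<close> or \<open>v\<^sub>i\<^sub>f\<close> with the right \<open>X\<^sub>0\<close>- and \<open>J X\<^sub>0\<close>-coefficients leaves a vector in
  \<open>S\<^sup>\<bottom>\<close> (\<open>eigenspace_perp\<close>, \<open>deformed_intersection_decomposition\<close>).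

  Finally, the projection to the tangent space is injective on these spaces: a cotangent
  vector \<open>u\<close> is isotropic for the pairing, and if \<open>K' u = s u\<close> then \<open>G'(u, u) = s \<langle>u, u\<rangle> = 0\<close>
  (\<open>eigenspace_anisotropic\<close>). Injective images of direct sums are direct.
\<close>

section \<open>Rescaling along an orthogonal family\<close>

locale orthogonal_family =
  fixes g :: "'v::real_vector \<Rightarrow> 'v \<Rightarrow> real" and I :: "'i set" and e :: "'i \<Rightarrow> 'v"
  assumes bilinear: "bilinear g"
    and sym: "g u v = g v u"
    and finite: "finite I"
    and orthogonal: "i \<in> I \<Longrightarrow> l \<in> I \<Longrightarrow> i \<noteq> l \<Longrightarrow> g (e i) (e l) = 0"
    and nonisotropic: "i \<in> I \<Longrightarrow> g (e i) (e i) \<noteq> 0"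
begin

lemma linear_left: "linear (\<lambda>u. g u v)" and linear_right: "linear (g u)"
  using bilinear by (auto simp: bilinear_def)

definition rescale :: "('i \<Rightarrow> real) \<Rightarrow> 'v \<Rightarrow> 'v" where
  "rescale c u = u + (\<Sum>i\<in>I. ((c i - 1) * g u (e i) / g (e i) (e i)) *\<^sub>R e i)"

lemma linear_rescale: "linear (rescale c)"
  by (rule linearI)
    (simp_all add: rescale_def linear_add[OF linear_left] linear_scale[OF linear_left]
      sum.distrib[symmetric] scaleR_sum_right algebra_simps add_divide_distrib diff_divide_distrib)

lemma rescale_coeff:
  assumes "l \<in> I"
  shows "g (rescale c u) (e l) = c l * g u (e l)"
proof -
  have "g (rescale c u) (e l)
      = g u (e l) + (\<Sum>i\<in>I. (c i - 1) * g u (e i) / g (e i) (e i) * g (e i) (e l))"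
    by (simp add: rescale_def linear_add[OF linear_left] linear_sum[OF linear_left]
        linear_scale[OF linear_left])
  also have "(\<Sum>i\<in>I. (c i - 1) * g u (e i) / g (e i) (e i) * g (e i) (e l))
      = (\<Sum>i\<in>I. if i = l then (c l - 1) * g u (e l) else 0)"
    using assms nonisotropic by (intro sum.cong) (auto simp: orthogonal)
  also have "\<dots> = (c l - 1) * g u (e l)"
    using assms finite by simp
  finally show ?thesis by (simp add: algebra_simps)
qed

lemma rescale_perp: "(\<And>i. i \<in> I \<Longrightarrow> g u (e i) = 0) \<Longrightarrow> rescale c u = u"
  by (simp add: rescale_def)

lemma rescale_eigenvector:
  assumes "l \<in> I"
  shows "rescale c (e l) = c l *\<^sub>R e l"
proof -
  have "(\<Sum>i\<in>I. ((c i - 1) * g (e l) (e i) / g (e i) (e i)) *\<^sub>R e i)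
      = (\<Sum>i\<in>I. if i = l then (c l - 1) *\<^sub>R e l else 0)"
    using assms nonisotropic by (intro sum.cong) (auto simp: orthogonal)
  also have "\<dots> = (c l - 1) *\<^sub>R e l"
    using assms finite by simp
  finally show ?thesis by (simp add: rescale_def algebra_simps)
qed

lemma rescale_rescale: "rescale c (rescale d u) = rescale (\<lambda>i. c i * d i) u"
proof -
  have "rescale c (rescale d u)
      = rescale d u + (\<Sum>i\<in>I. ((c i - 1) * d i * g u (e i) / g (e i) (e i)) *\<^sub>R e i)"
    by (simp add: rescale_def[of c] rescale_coeff mult.assoc)
  also have "\<dots> = u + (\<Sum>i\<in>I. ((d i - 1) * g u (e i) / g (e i) (e i)) *\<^sub>R e i
      + ((c i - 1) * d i * g u (e i) / g (e i) (e i)) *\<^sub>R e i)"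
    by (simp add: rescale_def sum.distrib)
  also have "\<dots> = rescale (\<lambda>i. c i * d i) u"
    unfolding rescale_def
    by (intro arg_cong2[where f = "(+)"] sum.cong refl)
      (simp add: scaleR_add_left[symmetric] add_divide_distrib[symmetric] algebra_simps
        del: scaleR_add_left)
  finally show ?thesis .
qed

lemma rescale_inverse:
  assumes "\<And>i. i \<in> I \<Longrightarrow> c i * d i = 1"
  shows "rescale c (rescale d u) = u"
  unfolding rescale_rescale using assms by (simp add: rescale_def)

lemma rescale_self_adjoint: "g (rescale c u) v = g u (rescale c v)"
proof -
  have "g (rescale c u) v = g u v + (\<Sum>i\<in>I. (c i - 1) * g u (e i) / g (e i) (e i) * g (e i) v)"
    by (simp add: rescale_def linear_add[OF linear_left] linear_sum[OF linear_left]
        linear_scale[OF linear_left])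
  also have "\<dots> = g u v + (\<Sum>i\<in>I. (c i - 1) * g v (e i) / g (e i) (e i) * g u (e i))"
    by (intro arg_cong2[where f = "(+)"] sum.cong refl) (simp add: sym[of "e _" v])
  also have "\<dots> = g u (rescale c v)"
    by (simp add: rescale_def linear_add[OF linear_right] linear_sum[OF linear_right]
        linear_scale[OF linear_right])
  finally show ?thesis .
qed

text \<open>Rescaling by zero projects onto the orthogonal complement of the family, so a linear map is
  determined by its values there and on the family.\<close>

lemma rescale_unique:
  assumes T: "linear T"
    and perp: "\<And>u. (\<And>i. i \<in> I \<Longrightarrow> g u (e i) = 0) \<Longrightarrow> T u = u"
    and ev: "\<And>i. i \<in> I \<Longrightarrow> T (e i) = c i *\<^sub>R e i"
  shows "T = rescale c"
proof
  fix u
  have decomp: "u = rescale (\<lambda>_. 0) u + (\<Sum>i\<in>I. (g u (e i) / g (e i) (e i)) *\<^sub>R e i)"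
    by (simp add: rescale_def sum_negf)
  have split: "F u = F (rescale (\<lambda>_. 0) u) + (\<Sum>i\<in>I. (g u (e i) / g (e i) (e i)) *\<^sub>R F (e i))"
    if "linear F" for F :: "'v \<Rightarrow> 'v"
    by (subst decomp) (simp add: linear_add[OF that] linear_sum[OF that] linear_scale[OF that])
  have "T (rescale (\<lambda>_. 0) u) = rescale c (rescale (\<lambda>_. 0) u)"
    by (subst perp) (simp_all add: rescale_coeff rescale_perp)
  then show "T u = rescale c u"
    unfolding split[OF T] split[OF linear_rescale[of c]] by (simp add: ev rescale_eigenvector)
qed

end

section \<open>The fibrewise decomposition\<close>

text \<open>
  A fibre of a generalized almost Hermitian structure with \<open>j\<close> and \<open>k\<close> in the roles of \<open>J\<close> and
  \<open>G\<^sup>e\<^sup>n\<^sup>d\<close>. The pairing is recovered as \<open>g (k u) v\<close>; the assumption \<open>x_isotropic\<close> is what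
  remains of \<open>x\<close> being tangent.
\<close>

locale hermitian_fibre =
  fixes g :: "'v::real_vector \<Rightarrow> 'v \<Rightarrow> real" and j k :: "'v \<Rightarrow> 'v" and x :: 'v and f :: real
  assumes bilinear_g: "bilinear g"
    and g_sym: "g u v = g v u"
    and g_pos: "u \<noteq> 0 \<Longrightarrow> g u u > 0"
    and linear_j: "linear j" and linear_k: "linear k"
    and j_j: "j (j u) = - u" and k_k: "k (k u) = u"
    and k_j: "k (j u) = j (k u)"
    and g_j_j: "g (j u) (j v) = g u v"
    and g_k_k: "g (k u) (k v) = g u v"
    and x_nonzero: "x \<noteq> 0"
    and x_isotropic: "g x (k x) = 0"
    and f_nonzero: "f \<noteq> 0"
begin

text \<open>The last vector is \<open>J\<^sub>3 X\<^sub>0\<close>, as \<open>j (k (j x)) = k (j (j x)) = - k x\<close>.\<close>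

definition frame :: "nat \<Rightarrow> 'v" where
  "frame = nth [x, j x, k (j x), - k x]"

definition weight :: "nat \<Rightarrow> real" where
  "weight = nth [f, f, 1 / f, 1 / f]"

lemma frame_simps:
  "frame 0 = x" "frame (Suc 0) = j x" "frame 2 = k (j x)" "frame 3 = - k x"
  by (simp_all add: frame_def)

lemma weight_simps: "weight 0 = f" "weight (Suc 0) = f" "weight 2 = 1 / f" "weight 3 = 1 / f"
  by (simp_all add: weight_def)

lemma less_four: "i \<in> {..<4::nat} \<longleftrightarrow> i = 0 \<or> i = Suc 0 \<or> i = 2 \<or> i = 3"
  by auto

lemmas j_simps = linear_add[OF linear_j] linear_diff[OF linear_j] linear_neg[OF linear_j]
  linear_scale[OF linear_j] linear_0[OF linear_j]
lemmas k_simps = linear_add[OF linear_k] linear_diff[OF linear_k] linear_neg[OF linear_k]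
  linear_scale[OF linear_k] linear_0[OF linear_k]
lemmas g_simps = bilinear_ladd[OF bilinear_g] bilinear_radd[OF bilinear_g]
  bilinear_lsub[OF bilinear_g] bilinear_rsub[OF bilinear_g]
  bilinear_lneg[OF bilinear_g] bilinear_rneg[OF bilinear_g]
  bilinear_lmul[OF bilinear_g] bilinear_rmul[OF bilinear_g]
  bilinear_lzero[OF bilinear_g] bilinear_rzero[OF bilinear_g]

lemma j_skew: "g (j u) v = - g u (j v)"
  using g_j_j[of u "j v"] by (simp add: j_j g_simps)

lemma k_symmetric: "g (k u) v = g u (k v)"
  using g_k_k[of u "k v"] by (simp add: k_k)

lemma g_j_self: "g u (j u) = 0"
  using j_skew[of u u] g_sym[of "j u" u] by simp

text \<open>Since \<open>j\<close> commutes with \<open>k\<close>, it is skew for the pairing \<open>g (k u) v\<close> as well.\<close>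

lemma g_k_j_self: "g u (k (j u)) = 0"
proof -
  have "g u (k (j u)) = g (k u) (j u)"
    by (simp add: k_symmetric)
  also have "\<dots> = - g (k (j u)) u"
    using j_skew[of "k u" u] by (simp add: k_j)
  also have "\<dots> = - g u (k (j u))"
    by (simp add: g_sym)
  finally show ?thesis by simp
qed

lemma frame_norms:
  "g (j x) (j x) = g x x" "g (k (j x)) (k (j x)) = g x x" "g (k x) (k x) = g x x"
  by (simp_all add: g_j_j g_k_k)

lemma frame_orthogonal:
  "g x (j x) = 0" "g x (k (j x)) = 0" "g x (k x) = 0"
  "g (j x) (k (j x)) = 0" "g (j x) (k x) = 0" "g (k (j x)) (k x) = 0"
proof -
  show "g x (j x) = 0" "g x (k (j x)) = 0" "g x (k x) = 0"
    by (simp_all add: g_j_self g_k_j_self x_isotropic)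
  show "g (j x) (k (j x)) = 0"
    by (simp add: k_j g_j_j x_isotropic)
  show "g (j x) (k x) = 0"
    using g_k_j_self[of x] k_symmetric[of "j x" x] g_sym[of x "k (j x)"] by simp
  show "g (k (j x)) (k x) = 0"
    using g_j_self[of x] g_sym[of x "j x"] by (simp add: g_k_k)
qed

sublocale orthogonal_family g "{..<4}" frame
proof
  show "bilinear g" "g u v = g v u" "finite {..<4::nat}" for u v
    by (simp_all add: bilinear_g g_sym)
  show "g (frame i) (frame l) = 0" if "i \<in> {..<4}" "l \<in> {..<4}" "i \<noteq> l" for i l
    using that frame_orthogonal unfolding less_four
    by (auto simp: frame_simps g_simps g_sym)
  show "g (frame i) (frame i) \<noteq> 0" if "i \<in> {..<4}" for i
    using that g_pos[OF x_nonzero] unfolding less_four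
    by (auto simp: frame_simps g_simps frame_norms)
qed

definition frame_perp :: "'v set" where
  "frame_perp = {u. \<forall>i<4. g u (frame i) = 0}"

lemma frame_perp_iff:
  "u \<in> frame_perp \<longleftrightarrow> g u x = 0 \<and> g u (j x) = 0 \<and> g u (k (j x)) = 0 \<and> g u (k x) = 0"
  by (simp add: frame_perp_def less_four[unfolded lessThan_iff] frame_simps g_simps
      imp_disjL all_conj_distrib)

definition deform :: "'v \<Rightarrow> 'v" where
  "deform = rescale weight"

definition deform_inv :: "'v \<Rightarrow> 'v" where
  "deform_inv = rescale (\<lambda>i. 1 / weight i)"

definition deformed_k :: "'v \<Rightarrow> 'v" where
  "deformed_k u = k (deform_inv (deform_inv u))"

lemma weight_nonzero: "i < 4 \<Longrightarrow> weight i \<noteq> 0"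
  unfolding less_four[unfolded lessThan_iff] using f_nonzero by (auto simp: weight_simps)

lemma deform_deform_inv: "deform (deform_inv u) = u" and deform_inv_deform: "deform_inv (deform u) = u"
  unfolding deform_def deform_inv_def by (rule rescale_inverse; simp add: weight_nonzero)+

lemma bij_deform: "bij deform"
  by (rule o_bij[of deform_inv]) (auto simp: deform_deform_inv deform_inv_deform)

lemma inv_deform: "inv deform = deform_inv"
  using deform_deform_inv deform_inv_deform by (intro inv_equality)

lemma linear_deform: "linear deform" and linear_deform_inv: "linear deform_inv"
  by (simp_all add: deform_def deform_inv_def linear_rescale)

lemma deform_frame_perp: "u \<in> frame_perp \<Longrightarrow> deform u = u"
  and deform_inv_frame_perp: "u \<in> frame_perp \<Longrightarrow> deform_inv u = u"
  by (auto simp: deform_def deform_inv_def frame_perp_def intro!: rescale_perp)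

lemma deform_frame: "i < 4 \<Longrightarrow> deform (frame i) = weight i *\<^sub>R frame i"
  and deform_inv_frame: "i < 4 \<Longrightarrow> deform_inv (frame i) = (1 / weight i) *\<^sub>R frame i"
  by (simp_all add: deform_def deform_inv_def rescale_eigenvector)

lemma deform_frame_vectors:
  "deform x = f *\<^sub>R x" "deform (j x) = f *\<^sub>R j x"
  "deform (k (j x)) = (1 / f) *\<^sub>R k (j x)" "deform (- k x) = (1 / f) *\<^sub>R (- k x)"
  using deform_frame[of 0] deform_frame[of "Suc 0"] deform_frame[of 2] deform_frame[of 3]
  by (simp_all only: frame_simps weight_simps)

lemma deform_unique:
  assumes "linear T" "\<And>u. u \<in> frame_perp \<Longrightarrow> T u = u"
    "T x = f *\<^sub>R x" "T (j x) = f *\<^sub>R j x"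
    "T (k (j x)) = (1 / f) *\<^sub>R k (j x)" "T (- k x) = (1 / f) *\<^sub>R (- k x)"
  shows "T = deform"
  unfolding deform_def
proof (rule rescale_unique[OF assms(1)])
  show "T u = u" if "\<And>i. i \<in> {..<4} \<Longrightarrow> g u (frame i) = 0" for u
    using that by (intro assms(2)) (simp add: frame_perp_def)
  show "T (frame i) = weight i *\<^sub>R frame i" if "i \<in> {..<4}" for i
    using that assms(3-6) unfolding less_four by (auto simp: frame_simps weight_simps)
qed

text \<open>
  The deformed metric is the pairing composed with \<open>deformed_k\<close>, which identifies the latter as
  the endomorphism of the deformed metric: self-adjointness moves both inverse rescalings to \<open>u\<close>.
\<close>

lemma deformed_metric: "g (deform_inv u) (deform_inv v) = g (k (deformed_k u)) v"
  by (simp add: deformed_k_def k_k deform_inv_def rescale_self_adjoint[symmetric])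

lemma linear_deformed_k: "linear deformed_k"
  using linear_compose[OF linear_compose[OF linear_deform_inv linear_deform_inv] linear_k]
  by (simp add: deformed_k_def[abs_def] o_def)

lemma deformed_k_frame:
  "deformed_k x = (1 / f\<^sup>2) *\<^sub>R k x" "deformed_k (j x) = (1 / f\<^sup>2) *\<^sub>R k (j x)"
  "deformed_k (k (j x)) = f\<^sup>2 *\<^sub>R j x" "deformed_k (k x) = f\<^sup>2 *\<^sub>R x"
proof -
  have *: "deform_inv x = (1 / f) *\<^sub>R x" "deform_inv (j x) = (1 / f) *\<^sub>R j x"
    "deform_inv (k (j x)) = f *\<^sub>R k (j x)" "deform_inv (k x) = f *\<^sub>R k x"
    using deform_inv_frame[of 0] deform_inv_frame[of "Suc 0"] deform_inv_frame[of 2]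
      deform_inv_frame[of 3]
    by (simp_all add: frame_simps weight_simps linear_neg[OF linear_deform_inv])
  show "deformed_k x = (1 / f\<^sup>2) *\<^sub>R k x" "deformed_k (j x) = (1 / f\<^sup>2) *\<^sub>R k (j x)"
    "deformed_k (k (j x)) = f\<^sup>2 *\<^sub>R j x" "deformed_k (k x) = f\<^sup>2 *\<^sub>R x"
    by (simp_all add: deformed_k_def * linear_scale[OF linear_deform_inv] k_simps k_k
        power2_eq_square)
qed

text \<open>For \<open>s = 1\<close> and \<open>s = -1\<close> this is the real part of \<open>v\<^sub>f\<close> and \<open>v\<^sub>i\<^sub>f\<close>, respectively.\<close>

definition eigenvector :: "real \<Rightarrow> 'v" where
  "eigenvector s = x + (s / f\<^sup>2) *\<^sub>R k x"

lemma eigenvector_eigen: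
  assumes "s\<^sup>2 = 1"
  shows "deformed_k (eigenvector s) = s *\<^sub>R eigenvector s"
    "deformed_k (j (eigenvector s)) = s *\<^sub>R j (eigenvector s)"
  using assms f_nonzero
  by (simp_all add: eigenvector_def linear_add[OF linear_deformed_k] k_j[symmetric]
      linear_scale[OF linear_deformed_k] deformed_k_frame j_simps algebra_simps power2_eq_square)

lemma eigenvector_coeffs:
  "g (eigenvector s) x = g x x" "g (eigenvector s) (j x) = 0"
  "g (j (eigenvector s)) x = 0" "g (j (eigenvector s)) (j x) = g x x"
  using frame_orthogonal
  by (simp_all add: eigenvector_def j_simps k_j[symmetric] g_simps frame_norms g_sym)

lemma deform_inv_twice_eq:
  assumes "deformed_k u = s *\<^sub>R u"
  shows "deform_inv (deform_inv u) = s *\<^sub>R k u"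
  using arg_cong[OF assms, of k] by (simp add: deformed_k_def k_k k_simps)

text \<open>
  The equation \<open>\<tau>\<^sup>-\<^sup>2 u = s k u\<close> ties the coefficient of \<open>u\<close> along \<open>k y\<close> to the one along \<open>y\<close>, for
  \<open>y = x\<close> and \<open>y = j x\<close>; so orthogonality to half of the frame gives orthogonality to all of it.
\<close>

lemma eigenspace_perp:
  assumes eig: "deformed_k u = s *\<^sub>R u" and "g u x = 0" "g u (j x) = 0"
  shows "u \<in> frame_perp" "k u = s *\<^sub>R u"
proof -
  have "(1 / weight i)\<^sup>2 * g u (frame i) = s * g u (k (frame i))" if "i < 4" for i
  proof -
    have "g (deform_inv (deform_inv u)) (frame i) = (1 / weight i)\<^sup>2 * g u (frame i)"
      using that by (simp add: deform_inv_def rescale_coeff power2_eq_square)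
    then show ?thesis
      by (simp add: deform_inv_twice_eq[OF eig] g_simps k_symmetric)
  qed
  from this[of 2] this[of 3] have "g u (k (j x)) = 0" "g u (k x) = 0"
    using assms f_nonzero by (simp_all add: frame_simps weight_simps k_simps k_k g_simps)
  with assms show perp: "u \<in> frame_perp"
    by (simp add: frame_perp_iff)
  show "k u = s *\<^sub>R u"
    using eig by (simp add: deformed_k_def deform_inv_frame_perp perp)
qed

lemma deformed_k_frame_perp: "u \<in> frame_perp \<Longrightarrow> deformed_k u = k u"
  by (simp add: deformed_k_def deform_inv_frame_perp)

text \<open>On an eigenspace of \<open>deformed_k\<close> the deformed metric, which is positive definite, is
  \<open>s\<close> times the pairing. This is what makes the tangent projection injective there.\<close>

lemma eigenspace_anisotropic:
  assumes "deformed_k u = s *\<^sub>R u" "g (k u) u = 0"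
  shows "u = 0"
proof -
  have "g (deform_inv u) (deform_inv u) = 0"
    by (simp add: deformed_metric assms k_simps g_simps)
  then have "deform_inv u = 0"
    using g_pos[of "deform_inv u"] by fastforce
  then show ?thesis
    using deform_deform_inv[of u] linear_0[OF linear_deform] by simp
qed

text \<open>
  In the next two sets the equations \<open>j z = \<i> z\<close> and \<open>k' z = s z\<close> or \<open>k z = s z\<close>
  are written out for real and imaginary parts, where \<open>k'\<close> is \<open>deformed_k\<close>. For \<open>s = 1\<close> they are \<open>L\<^sub>1 \<inter> L\<^sub>2'\<close> and
  \<open>L\<^sub>1 \<inter> L\<^sub>2 \<inter> S\<^sup>\<bottom>\<close>; for \<open>s = -1\<close> the bundles \<open>L\<^sub>2'\<close> and \<open>L\<^sub>2\<close> are replaced by their conjugates.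
\<close>

definition deformed_intersection :: "real \<Rightarrow> 'v cpx set" where
  "deformed_intersection s =
     {z. j (fst z) = - snd z \<and> j (snd z) = fst z \<and>
        deformed_k (fst z) = s *\<^sub>R fst z \<and> deformed_k (snd z) = s *\<^sub>R snd z}"

definition perp_intersection :: "real \<Rightarrow> 'v cpx set" where
  "perp_intersection s =
     {z. j (fst z) = - snd z \<and> j (snd z) = fst z \<and>
        k (fst z) = s *\<^sub>R fst z \<and> k (snd z) = s *\<^sub>R snd z \<and>
        fst z \<in> frame_perp \<and> snd z \<in> frame_perp}"

definition complex_eigenvector :: "real \<Rightarrow> 'v cpx" where
  "complex_eigenvector s = (eigenvector s, - j (eigenvector s))"

lemma cscale_complex_eigenvector:
  "cscale a (complex_eigenvector s) =
    (Re a *\<^sub>R eigenvector s + Im a *\<^sub>R j (eigenvector s),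
     Im a *\<^sub>R eigenvector s - Re a *\<^sub>R j (eigenvector s))"
  by (simp add: cscale_def complex_eigenvector_def)

lemma deformed_intersection_add:
  "y \<in> deformed_intersection s \<Longrightarrow> z \<in> deformed_intersection s \<Longrightarrow> y + z \<in> deformed_intersection s"
  by (simp add: deformed_intersection_def j_simps linear_add[OF linear_deformed_k] algebra_simps)

lemma deformed_intersection_diff:
  "y \<in> deformed_intersection s \<Longrightarrow> z \<in> deformed_intersection s \<Longrightarrow> y - z \<in> deformed_intersection s"
  by (simp add: deformed_intersection_def j_simps linear_diff[OF linear_deformed_k] algebra_simps)

lemma cscale_complex_eigenvector_mem:
  assumes "s\<^sup>2 = 1"
  shows "cscale a (complex_eigenvector s) \<in> deformed_intersection s"
  by (simp add: deformed_intersection_def cscale_complex_eigenvector j_simps j_j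
      linear_add[OF linear_deformed_k] linear_diff[OF linear_deformed_k]
      linear_scale[OF linear_deformed_k] eigenvector_eigen[OF assms] algebra_simps)

lemma perp_intersection_subset: "perp_intersection s \<subseteq> deformed_intersection s"
  by (auto simp: perp_intersection_def deformed_intersection_def deformed_k_frame_perp)

lemma deformed_intersection_decomposition:
  assumes s: "s\<^sup>2 = 1"
  shows "direct_sum_decomposition (deformed_intersection s)
    (cpx.span {complex_eigenvector s}) (perp_intersection s)"
  unfolding direct_sum_decomposition_def cpx.span_singleton
proof (intro conjI equalityI subsetI)
  fix z assume z: "z \<in> deformed_intersection s"
  \<comment> \<open>\<open>eigenvector s\<close> and its image under \<open>j\<close> have length-normalised coefficients \<open>(1, 0)\<close> and
    \<open>(0, 1)\<close> along \<open>x, j x\<close>, so this \<open>a\<close> cancels those of \<open>fst z\<close>; those of \<open>snd z\<close> then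
    vanish too because \<open>snd z = - j (fst z)\<close>.\<close>
  define a where "a = Complex (g (fst z) x / g x x) (g (fst z) (j x) / g x x)"
  let ?r = "z - cscale a (complex_eigenvector s)"
  have r: "?r \<in> deformed_intersection s"
    by (intro deformed_intersection_diff z cscale_complex_eigenvector_mem s)
  have pos: "g x x \<noteq> 0"
    using g_pos[OF x_nonzero] by simp
  have "snd z = - j (fst z)"
    using z by (simp add: deformed_intersection_def)
  then have "g (snd z) x = g (fst z) (j x)" "g (snd z) (j x) = - g (fst z) x"
    by (simp_all add: g_simps j_skew j_j)
  then have "g (fst ?r) x = 0" "g (fst ?r) (j x) = 0" "g (snd ?r) x = 0" "g (snd ?r) (j x) = 0"
    using pos by (simp_all add: cscale_complex_eigenvector a_def g_simps eigenvector_coeffs)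
  with r have "?r \<in> perp_intersection s"
    using eigenspace_perp[of "fst ?r" s] eigenspace_perp[of "snd ?r" s]
    unfolding perp_intersection_def deformed_intersection_def by blast
  then have "\<exists>v. z = cscale a (complex_eigenvector s) + v \<and> v \<in> perp_intersection s"
    by (intro exI[of _ ?r]) simp
  then show "z \<in> {u + v |u v. u \<in> range (\<lambda>a. cscale a (complex_eigenvector s))
      \<and> v \<in> perp_intersection s}"
    by blast
next
  fix z assume "z \<in> {u + v |u v. u \<in> range (\<lambda>a. cscale a (complex_eigenvector s))
      \<and> v \<in> perp_intersection s}"
  then show "z \<in> deformed_intersection s"
    using perp_intersection_subset cscale_complex_eigenvector_mem[OF s] deformed_intersection_add
    by blast
next
  fix z assume z: "z \<in> range (\<lambda>a. cscale a (complex_eigenvector s)) \<inter> perp_intersection s"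
  then obtain a where a: "z = cscale a (complex_eigenvector s)"
    by blast
  from z have "g (fst z) x = 0" "g (fst z) (j x) = 0"
    by (auto simp: perp_intersection_def frame_perp_iff)
  then have "a = 0"
    using g_pos[OF x_nonzero]
    by (simp add: a cscale_complex_eigenvector g_simps eigenvector_coeffs complex_eq_iff)
  then show "z \<in> {0}"
    by (simp add: a)
next
  fix z :: "'v cpx" assume "z \<in> {0}"
  moreover have "cscale 0 (complex_eigenvector s) = 0"
    by simp
  ultimately show "z \<in> range (\<lambda>a. cscale a (complex_eigenvector s)) \<inter> perp_intersection s"
    by (auto simp: perp_intersection_def frame_perp_iff j_simps k_simps g_simps
        intro: range_eqI[of _ _ 0])
qed

end

section \<open>Images of direct sums\<close>

lemma direct_sum_decomposition_image:
  assumes W: "direct_sum_decomposition W U V"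
    and sub: "U \<subseteq> W" "V \<subseteq> W"
    and diff: "\<And>y z. y \<in> W \<Longrightarrow> z \<in> W \<Longrightarrow> y - z \<in> W"
    and add: "\<And>y z. F (y + z) = F y + F z"
    and ker: "\<And>z. z \<in> W \<Longrightarrow> F z = 0 \<Longrightarrow> z = 0"
  shows "direct_sum_decomposition (F ` W) (F ` U) (F ` V)"
proof -
  have inj: "y = z" if "y \<in> W" "z \<in> W" "F y = F z" for y z
  proof -
    have "F y = F (y - z) + F z"
      by (simp flip: add)
    then show ?thesis
      using that ker[of "y - z"] diff by simp
  qed
  have W': "W = {u + v | u v. u \<in> U \<and> v \<in> V}" and UV: "U \<inter> V = {0}"
    using W by (auto simp: direct_sum_decomposition_def)
  have "F 0 = 0"
    using add[of 0 0] by simp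
  then have "F ` U \<inter> F ` V = {0}"
    using UV inj sub by (auto simp: image_iff) (metis Int_iff singletonD subsetD)+
  moreover have "F ` W = {u + v | u v. u \<in> F ` U \<and> v \<in> F ` V}"
    unfolding W' by (force simp: add)
  ultimately show ?thesis
    by (simp add: direct_sum_decomposition_def)
qed

lemma prT_add: "prT (y + z) = prT y + prT z"
  by (simp add: prT_def cpx_map_def)

lemma prT_cscale: "prT (cscale a z) = cscale a (prT z)"
  by (simp add: prT_def cpx_map_def cscale_def)

lemma prT_span_singleton: "prT ` cpx.span {z} = cpx.span {prT z}"
  by (simp add: cpx.span_singleton image_image prT_cscale)

section \<open>Bilinear forms and the pairing\<close>

lemma perp_span_iff:
  assumes "bilinear h"
  shows "(\<forall>s\<in>span B. h u s = 0) \<longleftrightarrow> (\<forall>s\<in>B. h u s = 0)"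
  using linear_eq_0_on_span[of "h u" B] assms by (auto simp: bilinear_def span_base)

lemma pairing_sym: "pairing u v = pairing v u"
  by (simp add: pairing_def)

lemma linear_pairing_left: "linear (\<lambda>u. pairing u v)"
  by (rule linearI) (simp_all add: pairing_def blinfun.bilinear_simps field_simps)

text \<open>Test against tangent vectors, and against the covectors dual to a vector by the inner product
  of the model space.\<close>

lemma pairing_nondegenerate:
  assumes "\<And>v. pairing w v = pairing w' v"
  shows "w = w'"
proof -
  have "blinfun_apply (snd w) y = blinfun_apply (snd w') y" for y
    using assms[of "(y, 0)"] by (simp add: pairing_def)
  moreover have "fst w \<bullet> b = fst w' \<bullet> b" for b
    using assms[of "(0, blinfun_inner_left b)"] by (simp add: pairing_def inner_commute)
  ultimately show ?thesis
    by (metis blinfun_eqI prod_eqI vector_eq_rdot)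
qed

text \<open>
  The covector part of the representing element is read off from \<open>h\<close> on tangent vectors. Its vector
  part comes from \<open>h\<close> on covectors, where finite dimension identifies the bidual with the
  space itself. The factors 2 undo the one half in the pairing.
\<close>

lemma pairing_representation:
  fixes h :: "'e::euclidean_space gtan \<Rightarrow> real"
  assumes h: "linear h"
  shows "\<exists>w. \<forall>v. h v = pairing w v"
proof -
  let ?w = "(\<Sum>b\<in>Basis. (2 * h (0, blinfun_inner_left b)) *\<^sub>R b, Blinfun (\<lambda>y. 2 * h (y, 0)))"
  have "linear (\<lambda>y. 2 * h (y, 0))"
  proof (rule linearI)
    show "2 * h (y + z, 0) = 2 * h (y, 0) + 2 * h (z, 0)" for y z
      using linear_add[OF h, of "(y, 0)" "(z, 0)"] by simp
    show "2 * h (r *\<^sub>R y, 0) = r *\<^sub>R (2 * h (y, 0))" for r y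
      using linear_scale[OF h, of r "(y, 0)"] by simp
  qed
  then have covector: "blinfun_apply (Blinfun (\<lambda>y. 2 * h (y, 0))) y = 2 * h (y, 0)" for y
    by (simp add: bounded_linear_Blinfun_apply linear_conv_bounded_linear)
  have vector: "h (0, \<xi>) = (\<Sum>b\<in>Basis. blinfun_apply \<xi> b * h (0, blinfun_inner_left b))"
    for \<xi> :: "'e \<Rightarrow>\<^sub>L real"
  proof -
    have "\<xi> = (\<Sum>b\<in>Basis. blinfun_apply \<xi> b *\<^sub>R blinfun_inner_left b)"
    proof (rule blinfun_eqI)
      fix y
      have "blinfun_apply \<xi> y = blinfun_apply \<xi> (\<Sum>b\<in>Basis. (y \<bullet> b) *\<^sub>R b)"
        by (simp add: euclidean_representation)
      then show "blinfun_apply \<xi> y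
          = blinfun_apply (\<Sum>b\<in>Basis. blinfun_apply \<xi> b *\<^sub>R blinfun_inner_left b) y"
        by (simp add: blinfun.bilinear_simps blinfun.sum_left blinfun.sum_right
            inner_commute mult.commute)
    qed
    then have "h (0, \<xi>) = h (0, \<Sum>b\<in>Basis. blinfun_apply \<xi> b *\<^sub>R blinfun_inner_left b)"
      by (rule arg_cong)
    moreover have lin: "linear (\<lambda>\<xi>. h (0, \<xi>))"
    proof (rule linearI)
      show "h (0, y + z) = h (0, y) + h (0, z)" for y z
        using linear_add[OF h, of "(0, y)" "(0, z)"] by simp
      show "h (0, r *\<^sub>R y) = r *\<^sub>R h (0, y)" for r y
        using linear_scale[OF h, of r "(0, y)"] by simp
    qed
    ultimately show ?thesis
      by (simp only: linear_sum[OF lin] linear_scale[OF lin] real_scaleR_def)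
  qed
  have covector_fst: "blinfun_apply (snd v) (fst ?w) = 2 * h (0, snd v)" for v
    by (subst vector) (simp add: blinfun.sum_right blinfun.scaleR_right sum_distrib_left mult_ac)
  have "pairing ?w v = h (fst v, 0) + h (0, snd v)" for v
    using covector_fst[of v] by (simp add: pairing_def covector)
  moreover have "h (fst v, 0) + h (0, snd v) = h v" for v
    unfolding linear_add[OF h, symmetric] by simp
  ultimately have "\<forall>v. h v = pairing ?w v"
    by metis
  then show ?thesis ..
qed

lemma Gend_eqI:
  assumes "\<And>v. G p u v = pairing w v"
  shows "Gend G p u = w"
  unfolding Gend_def using assms by (intro the_equality) (auto intro: pairing_nondegenerate)

lemma pairing_Gend:
  assumes "bilinear (G p)"
  shows "pairing (Gend G p u) v = G p u v"
proof -
  have "linear (G p u)"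
    using assms unfolding bilinear_def by blast
  then obtain w where w: "\<And>v. G p u v = pairing w v"
    using pairing_representation by blast
  then have "Gend G p u = w"
    by (intro Gend_eqI)
  with w show ?thesis
    by simp
qed

lemma linear_Gend:
  assumes "bilinear (G p)"
  shows "linear (Gend G p)"
proof (rule linearI)
  show "Gend G p (u + v) = Gend G p u + Gend G p v" for u v
    by (rule Gend_eqI) (simp add: linear_add[OF linear_pairing_left] pairing_Gend[of G p, OF assms]
        bilinear_ladd[OF assms])
  show "Gend G p (r *\<^sub>R u) = r *\<^sub>R Gend G p u" for r u
    by (rule Gend_eqI) (simp add: linear_scale[OF linear_pairing_left] pairing_Gend[of G p, OF assms]
        bilinear_lmul[OF assms])
qed

section \<open>Eigenbundles of the complexified structures\<close>

lemma L10_iff: "z \<in> L10 T p \<longleftrightarrow> T p (fst z) = - snd z \<and> T p (snd z) = fst z"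
  by (auto simp: L10_def cpx_map_def cscale_def prod_eq_iff)

lemma cnj_L10_iff:
  assumes "linear (T p)"
  shows "z \<in> cpx_cnj ` L10 T p \<longleftrightarrow> T p (fst z) = snd z \<and> T p (snd z) = - fst z"
proof -
  have "z \<in> cpx_cnj ` L10 T p \<longleftrightarrow> cpx_cnj z \<in> L10 T p"
    by (auto simp: cpx_cnj_def image_iff) (metis fst_conv snd_conv add.inverse_inverse prod.collapse)
  then show ?thesis
    by (auto simp: L10_iff cpx_cnj_def linear_neg[OF assms] minus_equation_iff)
qed

text \<open>On the \<open>i\<close>-eigenspace of \<open>J\<close>, the operator \<open>J\<^sub>2\<close> acts as \<open>i\<close> times \<open>G\<^sup>e\<^sup>n\<^sup>d\<close>.\<close>

lemma L10_Int_L10_J2_iff: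
  "z \<in> L10 J p \<inter> L10 (J2 G J) p \<longleftrightarrow> z \<in> L10 J p
    \<and> Gend G p (fst z) = fst z \<and> Gend G p (snd z) = snd z"
  if lin: "linear (Gend G p)"
  by (auto simp: L10_iff J2_def linear_neg[OF lin])

lemma L10_Int_cnj_L10_J2_iff:
  "z \<in> L10 J p \<inter> cpx_cnj ` L10 (J2 G J) p \<longleftrightarrow> z \<in> L10 J p
    \<and> Gend G p (fst z) = - fst z \<and> Gend G p (snd z) = - snd z"
  if lin: "linear (Gend G p)" and "linear (J p)"
proof -
  have "linear (J2 G J p)"
    using linear_compose[OF that(2) lin] by (simp add: J2_def[abs_def] o_def)
  then show ?thesis
    by (auto simp: cnj_L10_iff L10_iff J2_def linear_neg[OF lin] minus_equation_iff[of _ "snd z"])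
qed

theorem lemma9:
  fixes A :: "('m::{t2_space,second_countable_topology}, 'e::euclidean_space) chart set"
    and G :: "'m \<Rightarrow> 'e gtan \<Rightarrow> 'e gtan \<Rightarrow> real"
    and J :: "'m \<Rightarrow> 'e gtan \<Rightarrow> 'e gtan"
    and X0 :: "'m \<Rightarrow> 'e"
    and f :: "'m \<Rightarrow> real"
    and G' :: "'m \<Rightarrow> 'e gtan \<Rightarrow> 'e gtan \<Rightarrow> real"
    and L1 L2 L2' :: "'m \<Rightarrow> 'e gtan cpx set"
    and E2' :: "'m \<Rightarrow> 'e cpx set"
    and \<epsilon>2' :: "'m \<Rightarrow> 'e cpx \<Rightarrow> 'e cpx \<Rightarrow> complex"
  assumes manifold: "smooth_atlas A"
    and hermitian: "generalized_almost_hermitian A G J"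
    and type1: "constant_type J"
    and type2: "constant_type (J2 G J)"
    and X0_smooth: "smooth_vector_field_on A UNIV X0"
    and X0_nonvanishing: "\<And>p. X0 p \<noteq> 0"
    and f_smooth: "smooth_function_on A UNIV f"
    and f_nonvanishing: "\<And>p. f p \<noteq> 0"
    and L1_def: "L1 = L10 J"
    and L2_def: "L2 = L10 (J2 G J)"
    and G'_def: "G' = elementary_deformation G J X0 f"
    and L2'_def: "L2' = L10 (J2 G' J)"
    and E2'_subbundle: "complex_subbundle A E2'"
    and \<epsilon>2'_section: "smooth_two_form_on_subbundle A E2' \<epsilon>2'"
    and L2'_form: "L2' = L_of E2' \<epsilon>2'"
  shows "\<forall>p.
    direct_sum_decomposition (L1 p \<inter> L2' p)
      (cpx.span {v_f G J X0 f p})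
      (L1 p \<inter> L2 p \<inter> cpx_subspace (S_perp G J X0 p)) \<and>
    direct_sum_decomposition (L1 p \<inter> cpx_cnj ` L2' p)
      (cpx.span {v_if G J X0 f p})
      (L1 p \<inter> cpx_cnj ` L2 p \<inter> cpx_subspace (S_perp G J X0 p)) \<and>
    direct_sum_decomposition (prT ` (L1 p \<inter> L2' p))
      (cpx.span {prT (v_f G J X0 f p)})
      (prT ` (L1 p \<inter> L2 p \<inter> cpx_subspace (S_perp G J X0 p))) \<and>
    direct_sum_decomposition (prT ` (L1 p \<inter> cpx_cnj ` L2' p))
      (cpx.span {prT (v_if G J X0 f p)})
      (prT ` (L1 p \<inter> cpx_cnj ` L2 p \<inter> cpx_subspace (S_perp G J X0 p)))"
proof
  fix p
  let ?K = "Gend G p" and ?x = "gvec X0 p"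
  have bil: "bilinear (G p)" and sym: "\<And>u v. G p u v = G p v u"
    and pos: "\<And>u. u \<noteq> 0 \<Longrightarrow> G p u u > 0"
    and linJ: "linear (J p)" and JJ: "\<And>u. J p (J p u) = - u"
    and skew: "\<And>u v. pairing (J p u) v = - pairing u (J p v)"
    and GJ: "\<And>u v. G p (J p u) (J p v) = G p u v" and KK: "\<And>u. ?K (?K u) = u"
    using hermitian
    by (auto simp: generalized_almost_hermitian_def positive_definite_metric_def
        smooth_bilinear_form_def generalized_almost_complex_def smooth_endomorphism_def)
  note PK = pairing_Gend[of G p, OF bil]
  have KJ: "?K (J p u) = J p (?K u)" for u
  proof (rule Gend_eqI)
    fix v
    have "pairing (J p (?K u)) v = - G p u (J p v)"
      by (simp add: skew PK)
    also have "\<dots> = G p (J p u) v"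
      using GJ[of u "J p v"] by (simp add: JJ bilinear_rneg[OF bil])
    finally show "G p (J p u) v = pairing (J p (?K u)) v" by simp
  qed
  interpret hermitian_fibre "G p" "J p" ?K ?x "f p"
  proof (rule hermitian_fibre.intro)
    show "G p (?K u) (?K v) = G p u v" for u v
      using PK[of "?K u" "?K v"] PK[of v u] by (simp add: KK pairing_sym[of u] sym[of u])
    show "?x \<noteq> 0"
      using X0_nonvanishing by (simp add: gvec_def prod_eq_iff)
    \<comment> \<open>\<open>X\<^sub>0\<close> is tangent, hence isotropic for the pairing.\<close>
    show "G p ?x (?K ?x) = 0"
      using PK[of "?x" "?K ?x"] sym PK[of "?K ?x" "?x"] by (simp add: KK pairing_def gvec_def)
  qed (simp_all add: bil sym pos linJ linear_Gend[of G p, OF bil] JJ KK KJ GJ f_nonvanishing)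
  have J3: "J3 G J p ?x = - ?K ?x"
    by (simp add: J3_def J2_def KJ JJ)
  have perp: "S_perp G J X0 p = frame_perp"
    unfolding S_perp_def S_bundle_def perp_span_iff[OF bil] set_eq_iff frame_perp_iff mem_Collect_eq J3
    by (simp add: J2_def g_simps)
  have tau: "elementary_tau G J X0 f p = deform"
    unfolding elementary_tau_def J3 J2_def perp
    using linear_deform bij_deform deform_frame_perp deform_frame_vectors
    by (intro the_equality) (simp, blast intro: deform_unique)
  have K': "Gend G' p = deformed_k"
  proof
    fix u
    have "G' p u v = pairing (deformed_k u) v" for v
    proof -
      have "G' p u v = G p (?K (deformed_k u)) v"
        by (simp add: G'_def elementary_deformation_def tau inv_deform deformed_metric)
      then show ?thesis
        by (simp add: PK[symmetric] KK)
    qed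
    then show "Gend G' p u = deformed_k u"
      by (rule Gend_eqI)
  qed
  have v: "v_f G J X0 f p = complex_eigenvector 1" "v_if G J X0 f p = complex_eigenvector (-1)"
    by (simp_all add: v_f_def v_if_def J3 J2_def complex_eigenvector_def eigenvector_def cscale_def
        cpx_of_def j_simps KJ)
  note lin = linear_Gend[of G p, OF bil] linear_deformed_k[folded K']
  have sets: "L1 p \<inter> L2' p = deformed_intersection 1"
    "L1 p \<inter> cpx_cnj ` L2' p = deformed_intersection (-1)"
    "L1 p \<inter> L2 p \<inter> cpx_subspace (S_perp G J X0 p) = perp_intersection 1"
    "L1 p \<inter> cpx_cnj ` L2 p \<inter> cpx_subspace (S_perp G J X0 p) = perp_intersection (-1)"
    unfolding L1_def L2_def L2'_def set_eq_iff
    by (auto simp only: Int_iff[of _ "_ \<inter> _"]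
        L10_Int_L10_J2_iff[of G p, OF lin(1)] L10_Int_L10_J2_iff[of G' p, OF lin(2)]
        L10_Int_cnj_L10_J2_iff[of G p J, OF lin(1) linJ]
        L10_Int_cnj_L10_J2_iff[of G' p J, OF lin(2) linJ]
        L10_iff deformed_intersection_def perp_intersection_def K' perp cpx_subspace_def
        mem_Times_iff mem_Collect_eq scaleR_one scaleR_minus1_left)
  \<comment> \<open>The kernel of the tangent projection is the cotangent space, which is isotropic.\<close>
  have kernel: "z = 0" if "z \<in> deformed_intersection s" "prT z = 0" for z s
  proof -
    have "G p (?K u) u = 0" if "fst u = 0" for u :: "'e gtan"
      using that PK[of "?K u" u] by (simp add: KK pairing_def)
    then show ?thesis
      using that eigenspace_anisotropic[of _ s]
      by (auto simp: deformed_intersection_def prT_def cpx_map_def prod_eq_iff)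
  qed
  have image: "direct_sum_decomposition (prT ` deformed_intersection s)
      (cpx.span {prT (complex_eigenvector s)}) (prT ` perp_intersection s)" if "s\<^sup>2 = 1" for s
    unfolding prT_span_singleton[symmetric]
    using perp_intersection_subset cscale_complex_eigenvector_mem[OF that] kernel[of _ s]
    by (intro direct_sum_decomposition_image[OF deformed_intersection_decomposition[OF that]])
      (auto simp: cpx.span_singleton prT_add deformed_intersection_diff)
  show "direct_sum_decomposition (L1 p \<inter> L2' p)
      (cpx.span {v_f G J X0 f p})
      (L1 p \<inter> L2 p \<inter> cpx_subspace (S_perp G J X0 p)) \<and>
    direct_sum_decomposition (L1 p \<inter> cpx_cnj ` L2' p)
      (cpx.span {v_if G J X0 f p})
      (L1 p \<inter> cpx_cnj ` L2 p \<inter> cpx_subspace (S_perp G J X0 p)) \<and>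
    direct_sum_decomposition (prT ` (L1 p \<inter> L2' p))
      (cpx.span {prT (v_f G J X0 f p)})
      (prT ` (L1 p \<inter> L2 p \<inter> cpx_subspace (S_perp G J X0 p))) \<and>
    direct_sum_decomposition (prT ` (L1 p \<inter> cpx_cnj ` L2' p))
      (cpx.span {prT (v_if G J X0 f p)})
      (prT ` (L1 p \<inter> cpx_cnj ` L2 p \<inter> cpx_subspace (S_perp G J X0 p)))"
    unfolding sets v by (intro conjI deformed_intersection_decomposition image) simp_all
qed

end
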